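(* Let $A$ and $B\ge 0$ be two random variables on a common probability space such that $$E\exp\Big\{\lambda A-\frac{\lambda^2}{2}B^2\Big\}\le 1\qquad\text{for all }\lambda\in\mathbf{R}.$$ Then for all $x\ge\sqrt{2}$, $y>0$ and $p>0$, $$P\left(|A|\Big/\sqrt{(B^2+y)\Big(1+\frac12\log\Big(\frac{B^2}{y}+1\Big)\Big)}\ge x\right)\le\exp\Big(-\frac{x^2}{2}\Big),$$ $$E\left(|A|\Big/\sqrt{(B^2+y)\Big(1+\frac12\log\Big(\frac{B^2}{y}+1\Big)\Big)}\right)^p\le 2^{p/2}+2^{(p-2)/2}\,p\,\Gamma\Big(\frac p2\Big).$$
   Context: $\Gamma$ is the Gamma function and $\log$ the natural logarithm. *)

theory Defs
  imports "HOL-Probability.Probability"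
begin

text \<open>
  Expectations of nonnegative quantities are rendered as Lebesgue integrals with values in
  \<^typ>\<open>ennreal\<close>. The Bochner integral of a non-integrable function is 0, so a Bochner reading of a
  hypothesis or conclusion of the form E Y \<le> c would hold vacuously when E Y is infinite.
\<close>

end

theory Submission
  imports Defs
begin

text \<open>
  The proof is the method of mixtures. The hypothesis bounds an exponential moment for each fixed
  \<open>t\<close>, whereas the exponent \<open>t A - t\<^sup>2 B\<^sup>2 / 2\<close> is largest, where \<open>B > 0\<close>, at the random point
  \<open>t = A / B\<^sup>2\<close>. Averaging the hypothesis over \<open>t\<close> with a centred Gaussian weight of variance \<open>1 / y\<close> reaches this
  point up to a small loss: by Tonelli and the Gaussian integral,
  \<open>E Z \<le> 1\<close> for \<open>Z = sqrt (y / (B\<^sup>2 + y)) * exp (A\<^sup>2 / (2 * (B\<^sup>2 + y)))\<close>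
  (lemma \<open>nn_integral_gaussian_mixture_le_1\<close>).

  Let \<open>W\<close> be the self-normalized quotient. The logarithm in its denominator is what pays for the
  factor \<open>sqrt (y / (B\<^sup>2 + y))\<close>: when \<open>x\<^sup>2 \<ge> 2\<close>, the event \<open>W \<ge> x\<close> forces
  \<open>Z \<ge> exp (x\<^sup>2 / 2)\<close> (lemma \<open>mixture_lower_bound\<close>), and Markov's inequality gives the tail bound.

  In terms of \<open>Q = W\<^sup>2 / 2\<close> this tail bound reads \<open>P (Q \<ge> u) \<le> exp (- u)\<close> for \<open>u \<ge> 1\<close>.
  Integrating it against the derivative of \<open>u powr (p / 2)\<close> produces the Gamma integral
  (lemma \<open>nn_integral_powr_le_of_exp_tail\<close>), and \<open>W powr p = 2 powr (p / 2) * Q powr (p / 2)\<close>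
  gives the stated constants.
\<close>

text \<open>
  Completing the square in \<open>t\<close>: a Gaussian weight times \<open>exp (t * a - t\<^sup>2 / 2 * v)\<close> is
  again a Gaussian weight up to a constant, with the precisions \<open>y\<close> and \<open>v\<close> added and the mean moved. Stated with
  normalized densities on both sides, this constant is the value of the integral over \<open>t\<close>.
\<close>
lemma normal_density_exp_tilt:
  fixes a v y t :: real
  assumes "v \<ge> 0" "y > 0"
  shows "normal_density 0 (1 / sqrt y) t * exp (t * a - t\<^sup>2 / 2 * v)
       = sqrt (y / (v + y)) * exp (a\<^sup>2 / (2 * (v + y)))
         * normal_density (a / (v + y)) (1 / sqrt (v + y)) t"
proof -
  have c: "v + y > 0" using assms by simp
  have e: "- (t\<^sup>2 * y / 2) + (t * a - t\<^sup>2 / 2 * v)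
      = a\<^sup>2 / (2 * (v + y)) + - ((t - a / (v + y))\<^sup>2 * (v + y) / 2)"
  proof -
    have "(t - a / (v + y))\<^sup>2 * (v + y) = t\<^sup>2 * (v + y) - 2 * t * a + a\<^sup>2 / (v + y)"
      using c by (simp add: power2_diff power_divide left_diff_distrib distrib_right)
                 (simp add: divide_simps power2_eq_square)
    moreover have "a\<^sup>2 / (2 * (v + y)) = a\<^sup>2 / (v + y) / 2" by simp
    ultimately show ?thesis
      by (simp only:) (simp add: algebra_simps add_divide_distrib diff_divide_distrib)
  qed
  have n: "normal_density m (1 / sqrt s) t = sqrt s / sqrt (2 * pi) * exp (- ((t - m)\<^sup>2 * s / 2))"
    if "s > 0" for m s :: real
    using that by (simp add: normal_density_def power_divide real_sqrt_divide real_sqrt_mult)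
  have "normal_density 0 (1 / sqrt y) t * exp (t * a - t\<^sup>2 / 2 * v)
      = sqrt y / sqrt (2 * pi) * exp (- (t\<^sup>2 * y / 2) + (t * a - t\<^sup>2 / 2 * v))"
    unfolding n[OF assms(2)] exp_add by simp
  also have "\<dots> = sqrt y / sqrt (2 * pi)
      * (exp (a\<^sup>2 / (2 * (v + y))) * exp (- ((t - a / (v + y))\<^sup>2 * (v + y) / 2)))"
    by (simp only: e exp_add)
  also have "\<dots> = sqrt (y / (v + y)) * exp (a\<^sup>2 / (2 * (v + y)))
         * normal_density (a / (v + y)) (1 / sqrt (v + y)) t"
    using c by (simp add: n real_sqrt_divide)
  finally show ?thesis .
qed

lemma nn_integral_normal_density_eq_1:
  assumes "\<sigma> > 0"
  shows "(\<integral>\<^sup>+t. ennreal (normal_density \<mu> \<sigma> t) \<partial>lborel) = 1"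
  using prob_space.emeasure_space_1[OF prob_space_normal_density[OF assms, of \<mu>]]
  by (simp add: emeasure_density)

text \<open>
  A probability average over \<open>t\<close> of quantities at most 1 is at most 1; exchanging this average with
  the expectation evaluates the mixture in closed form for each \<open>\<omega>\<close>.
\<close>
lemma nn_integral_gaussian_mixture_le_1:
  fixes A B :: "'a \<Rightarrow> real" and y :: real
  assumes "prob_space M"
    and [measurable]: "A \<in> borel_measurable M" "B \<in> borel_measurable M"
    and le1: "\<And>t::real. (\<integral>\<^sup>+\<omega>. ennreal (exp (t * A \<omega> - t\<^sup>2 / 2 * (B \<omega>)\<^sup>2)) \<partial>M) \<le> 1"
    and y: "y > 0"
  shows "(\<integral>\<^sup>+\<omega>. ennreal (sqrt (y / ((B \<omega>)\<^sup>2 + y)) * exp ((A \<omega>)\<^sup>2 / (2 * ((B \<omega>)\<^sup>2 + y)))) \<partial>M) \<le> 1"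
proof -
  interpret prob_space M by fact
  interpret pair_sigma_finite M lborel ..
  define \<phi> where "\<phi> = normal_density 0 (1 / sqrt y)"
  have [measurable]: "\<phi> \<in> borel_measurable borel" by (simp add: \<phi>_def)
  have \<phi>: "\<phi> t \<ge> 0" for t by (simp add: \<phi>_def)
  define K where "K \<omega> = sqrt (y / ((B \<omega>)\<^sup>2 + y)) * exp ((A \<omega>)\<^sup>2 / (2 * ((B \<omega>)\<^sup>2 + y)))" for \<omega>
  have inner: "(\<integral>\<^sup>+t. ennreal (\<phi> t * exp (t * A \<omega> - t\<^sup>2 / 2 * (B \<omega>)\<^sup>2)) \<partial>lborel) = ennreal (K \<omega>)" for \<omega>
  proof -
    have s: "1 / sqrt ((B \<omega>)\<^sup>2 + y) > 0"
      using y by (simp add: add_nonneg_pos)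
    have "(\<integral>\<^sup>+t. ennreal (\<phi> t * exp (t * A \<omega> - t\<^sup>2 / 2 * (B \<omega>)\<^sup>2)) \<partial>lborel)
        = (\<integral>\<^sup>+t. ennreal (K \<omega>) * ennreal (normal_density (A \<omega> / ((B \<omega>)\<^sup>2 + y)) (1 / sqrt ((B \<omega>)\<^sup>2 + y)) t) \<partial>lborel)"
      unfolding \<phi>_def K_def using y
      by (subst normal_density_exp_tilt) (simp_all add: ennreal_mult'')
    also have "\<dots> = ennreal (K \<omega>)"
      by (simp add: nn_integral_cmult nn_integral_normal_density_eq_1[OF s])
    finally show ?thesis .
  qed
  have "(\<integral>\<^sup>+\<omega>. ennreal (K \<omega>) \<partial>M)
      = (\<integral>\<^sup>+\<omega>. (\<integral>\<^sup>+t. ennreal (\<phi> t * exp (t * A \<omega> - t\<^sup>2 / 2 * (B \<omega>)\<^sup>2)) \<partial>lborel) \<partial>M)"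
    by (simp only: inner)
  also have "\<dots> = (\<integral>\<^sup>+t. (\<integral>\<^sup>+\<omega>. ennreal (\<phi> t * exp (t * A \<omega> - t\<^sup>2 / 2 * (B \<omega>)\<^sup>2)) \<partial>M) \<partial>lborel)"
    by (rule Fubini'[symmetric]) measurable
  also have "\<dots> = (\<integral>\<^sup>+t. ennreal (\<phi> t) * (\<integral>\<^sup>+\<omega>. ennreal (exp (t * A \<omega> - t\<^sup>2 / 2 * (B \<omega>)\<^sup>2)) \<partial>M) \<partial>lborel)"
    by (simp add: ennreal_mult \<phi> nn_integral_cmult)
  also have "\<dots> \<le> (\<integral>\<^sup>+t. ennreal (\<phi> t) * 1 \<partial>lborel)"
    by (intro nn_integral_mono mult_left_mono le1) auto
  also have "\<dots> = 1"
    using y by (simp add: \<phi>_def nn_integral_normal_density_eq_1)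
  finally show ?thesis by (simp add: K_def)
qed

text \<open>
  The deterministic half of the tail bound. With \<open>L = ln (v / y + 1)\<close>, the assumption gives
  \<open>a\<^sup>2 / (2 * (v + y)) \<ge> x\<^sup>2 / 2 + x\<^sup>2 * L / 4\<close>, while the square root is \<open>exp (- (L / 2))\<close>.
  The second summand compensates this loss exactly when \<open>x\<^sup>2 \<ge> 2\<close> (or \<open>L = 0\<close>), which is the reason
  for the threshold \<open>sqrt 2\<close>.
\<close>
lemma mixture_lower_bound:
  fixes a v x y :: real
  assumes v: "v \<ge> 0" and y: "y > 0" and x: "x \<ge> sqrt 2"
    and le: "x \<le> \<bar>a\<bar> / sqrt ((v + y) * (1 + 1 / 2 * ln (v / y + 1)))"
  shows "exp (x\<^sup>2 / 2) \<le> sqrt (y / (v + y)) * exp (a\<^sup>2 / (2 * (v + y)))"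
proof -
  define L where "L = ln (v / y + 1)"
  have L: "L \<ge> 0" using v y by (simp add: L_def)
  have c: "v + y > 0" using v y by simp
  define D where "D = (v + y) * (1 + 1 / 2 * L)"
  have D: "D > 0" using c L by (simp add: D_def add_pos_nonneg)
  have x2: "x\<^sup>2 \<ge> 2" and x0: "x \<ge> 0"
    using x power_mono[OF x, of 2] real_sqrt_ge_zero[of 2] by (simp, linarith)
  have "x * sqrt D \<le> \<bar>a\<bar>"
    using le D unfolding L_def[symmetric] D_def[symmetric] by (simp add: pos_le_divide_eq)
  then have "(x * sqrt D)\<^sup>2 \<le> \<bar>a\<bar>\<^sup>2"
    using x0 D by (intro power_mono) auto
  then have "x\<^sup>2 * (1 + 1 / 2 * L) * (v + y) \<le> a\<^sup>2"
    using D by (simp add: power_mult_distrib D_def ac_simps)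
  then have "x\<^sup>2 * (1 + 1 / 2 * L) \<le> a\<^sup>2 / (v + y)"
    using c by (simp only: pos_le_divide_eq)
  moreover define m where "m = a\<^sup>2 / (v + y)"
  ultimately have "x\<^sup>2 + x\<^sup>2 * L / 2 \<le> m"
    by (simp add: algebra_simps)
  moreover have "x\<^sup>2 * L \<ge> 2 * L" using x2 L by (rule mult_right_mono)
  ultimately have "x\<^sup>2 / 2 \<le> - (L / 2) + m / 2"
    by linarith
  then have *: "x\<^sup>2 / 2 \<le> - (L / 2) + a\<^sup>2 / (2 * (v + y))"
    by (simp only: m_def divide_divide_eq_left mult.commute)
  have "sqrt (y / (v + y)) = exp (- (L / 2))"
  proof -
    have "exp L = (v + y) / y" using v y by (simp add: L_def add_nonneg_pos field_simps)
    moreover have "(exp (- (L / 2)))\<^sup>2 = inverse (exp L)"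
      by (simp add: power2_eq_square mult_exp_exp exp_minus[symmetric])
    ultimately have "(exp (- (L / 2)))\<^sup>2 = y / (v + y)" by simp
    then show ?thesis by (metis exp_ge_zero real_sqrt_unique)
  qed
  then show ?thesis using * by (simp add: exp_add[symmetric])
qed

lemma powr_eq_nn_integral_layers:
  fixes w q :: real
  assumes "w \<ge> 0" "q > 0"
  shows "ennreal (w powr q) = (\<integral>\<^sup>+u. ennreal (q * u powr (q - 1)) * indicator {0..w} u \<partial>lborel)"
proof -
  have "((\<lambda>u. q * u powr (q - 1)) has_integral w powr q) {0..w}"
    using has_integral_mult_right[OF has_integral_powr_from_0[of "q - 1" w], of q] assms by simp
  from nn_integral_has_integral_lebesgue'[OF _ this] show ?thesis
    using assms by simp
qed

text \<open>
  Below level 1 the tail probability is bounded by 1, which contributes the integral of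
  \<open>q * u powr (q - 1)\<close> over \<open>{0..1}\<close>, that is, 1. Above level 1 it is bounded by \<open>exp (- u)\<close>;
  enlarging the range of integration to \<open>{0..}\<close> gives \<open>q * Gamma q\<close>.
\<close>
lemma nn_integral_powr_le_of_exp_tail:
  fixes Q :: "'a \<Rightarrow> real" and q :: real
  assumes "prob_space M" and [measurable]: "Q \<in> borel_measurable M"
    and Q0: "\<And>\<omega>. Q \<omega> \<ge> 0"
    and tail: "\<And>u. u \<ge> 1 \<Longrightarrow> emeasure M {\<omega> \<in> space M. u \<le> Q \<omega>} \<le> ennreal (exp (- u))"
    and q: "q > 0"
  shows "(\<integral>\<^sup>+\<omega>. ennreal (Q \<omega> powr q) \<partial>M) \<le> ennreal (1 + q * Gamma q)"
proof -
  interpret prob_space M by fact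
  interpret pair_sigma_finite M lborel ..
  have Gamma: "(\<integral>\<^sup>+u. ennreal (u powr (q - 1) * exp (- u)) * indicator {0..} u \<partial>lborel)
      = ennreal (Gamma q)"
    using nn_integral_has_integral_lebesgue'[OF _ Gamma_integral_real[OF q]]
    by (simp add: exp_minus field_simps)
  define g where "g u = ennreal (q * u powr (q - 1))" for u
  have [measurable]: "g \<in> borel_measurable borel" unfolding g_def by measurable
  have "(\<integral>\<^sup>+\<omega>. ennreal (Q \<omega> powr q) \<partial>M)
      = (\<integral>\<^sup>+\<omega>. (\<integral>\<^sup>+u. g u * indicator {0..Q \<omega>} u \<partial>lborel) \<partial>M)"
    by (simp add: powr_eq_nn_integral_layers Q0 q g_def)
  \<comment> \<open>The constraint \<open>u \<le> Q \<omega>\<close> is written as membership in one set of pairs, which shows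
      the joint measurability that Tonelli requires.\<close>
  also have "\<dots> = (\<integral>\<^sup>+\<omega>. (\<integral>\<^sup>+u. g u * indicator {0..} u * indicator {z \<in> space (M \<Otimes>\<^sub>M lborel). snd z \<le> Q (fst z)} (\<omega>, u) \<partial>lborel) \<partial>M)"
    by (intro nn_integral_cong) (auto simp: indicator_def space_pair_measure)
  also have "\<dots> = (\<integral>\<^sup>+u. (\<integral>\<^sup>+\<omega>. g u * indicator {0..} u * indicator {z \<in> space (M \<Otimes>\<^sub>M lborel). snd z \<le> Q (fst z)} (\<omega>, u) \<partial>M) \<partial>lborel)"
    by (rule Fubini'[symmetric]) measurable
  also have "\<dots> = (\<integral>\<^sup>+u. (\<integral>\<^sup>+\<omega>. g u * indicator {0..} u * indicator {\<omega> \<in> space M. u \<le> Q \<omega>} \<omega> \<partial>M) \<partial>lborel)"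
    by (intro nn_integral_cong) (auto simp: indicator_def space_pair_measure)
  also have "\<dots> = (\<integral>\<^sup>+u. g u * indicator {0..} u * emeasure M {\<omega> \<in> space M. u \<le> Q \<omega>} \<partial>lborel)"
    by (simp add: nn_integral_cmult_indicator)
  also have "\<dots> \<le> (\<integral>\<^sup>+u. g u * indicator {0..1} u
      + ennreal q * (ennreal (u powr (q - 1) * exp (- u)) * indicator {0..} u) \<partial>lborel)"
  proof (rule nn_integral_mono)
    fix u :: real
    show "g u * indicator {0..} u * emeasure M {\<omega> \<in> space M. u \<le> Q \<omega>}
      \<le> g u * indicator {0..1} u + ennreal q * (ennreal (u powr (q - 1) * exp (- u)) * indicator {0..} u)"
    proof (cases "u \<le> 1")
      case True
      have "g u * indicator {0..} u * emeasure M {\<omega> \<in> space M. u \<le> Q \<omega>} \<le> g u * indicator {0..} u * 1"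
        by (intro mult_left_mono emeasure_le_1) auto
      also have "\<dots> = g u * indicator {0..1} u" using True by (simp add: indicator_def)
      finally show ?thesis by (simp add: add_increasing2)
    next
      case False
      have "g u * indicator {0..} u * emeasure M {\<omega> \<in> space M. u \<le> Q \<omega>}
          \<le> g u * indicator {0..} u * ennreal (exp (- u))"
        using False by (intro mult_left_mono tail) auto
      also have "\<dots> = ennreal q * (ennreal (u powr (q - 1) * exp (- u)) * indicator {0..} u)"
        using q by (simp add: g_def ennreal_mult ac_simps)
      finally show ?thesis by (simp add: add_increasing)
    qed
  qed
  also have "\<dots> = 1 + ennreal q * ennreal (Gamma q)"
    using powr_eq_nn_integral_layers[of 1 q] q
    by (simp add: nn_integral_add nn_integral_cmult Gamma g_def)
  also have "\<dots> = ennreal (1 + q * Gamma q)"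
    using q Gamma_real_pos[OF q] by (simp add: ennreal_mult)
  finally show ?thesis .
qed

theorem corollary2p2:
  fixes M :: "'a measure" and A B :: "'a \<Rightarrow> real" and x y p :: real
  assumes "prob_space M"
    and "A \<in> borel_measurable M" and "B \<in> borel_measurable M"
    and "AE \<omega> in M. B \<omega> \<ge> 0"
    and "\<And>t::real. (\<integral>\<^sup>+\<omega>. ennreal (exp (t * A \<omega> - t\<^sup>2 / 2 * (B \<omega>)\<^sup>2)) \<partial>M) \<le> 1"
    and "x \<ge> sqrt 2" and "y > 0" and "p > 0"
  shows "\<P>(\<omega> in M. \<bar>A \<omega>\<bar> / sqrt (((B \<omega>)\<^sup>2 + y) * (1 + 1 / 2 * ln ((B \<omega>)\<^sup>2 / y + 1))) \<ge> x)
           \<le> exp (- (x\<^sup>2 / 2))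
       \<and> (\<integral>\<^sup>+\<omega>. ennreal ((\<bar>A \<omega>\<bar> / sqrt (((B \<omega>)\<^sup>2 + y) * (1 + 1 / 2 * ln ((B \<omega>)\<^sup>2 / y + 1)))) powr p) \<partial>M)
           \<le> ennreal (2 powr (p / 2) + 2 powr ((p - 2) / 2) * p * Gamma (p / 2))"
proof -
  interpret prob_space M by fact
  note [measurable] = assms(2,3)
  have y: "y > 0" and p: "p > 0" by fact+
  define W where "W \<omega> = \<bar>A \<omega>\<bar> / sqrt (((B \<omega>)\<^sup>2 + y) * (1 + 1 / 2 * ln ((B \<omega>)\<^sup>2 / y + 1)))" for \<omega>
  define Z where "Z \<omega> = sqrt (y / ((B \<omega>)\<^sup>2 + y)) * exp ((A \<omega>)\<^sup>2 / (2 * ((B \<omega>)\<^sup>2 + y)))" for \<omega>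
  have [measurable]: "W \<in> borel_measurable M" "Z \<in> borel_measurable M"
    unfolding W_def Z_def by measurable
  have W0: "W \<omega> \<ge> 0" for \<omega>
    using y by (simp add: W_def add_nonneg_nonneg)
  have EZ: "(\<integral>\<^sup>+\<omega>. ennreal (Z \<omega>) \<partial>M) \<le> 1"
    unfolding Z_def using assms by (intro nn_integral_gaussian_mixture_le_1) auto
  have tail: "emeasure M {\<omega> \<in> space M. r \<le> W \<omega>} \<le> ennreal (exp (- (r\<^sup>2 / 2)))"
    if r: "r \<ge> sqrt 2" for r
  proof -
    have sub: "exp (r\<^sup>2 / 2) \<le> Z \<omega>" if "r \<le> W \<omega>" for \<omega>
      using mixture_lower_bound[OF _ y r, of "(B \<omega>)\<^sup>2" "A \<omega>"] that by (simp add: W_def Z_def)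
    have one: "1 \<le> ennreal (exp (- (r\<^sup>2 / 2))) * ennreal (Z \<omega>)" if "r \<le> W \<omega>" for \<omega>
    proof -
      have "exp (- (r\<^sup>2 / 2)) * exp (r\<^sup>2 / 2) \<le> exp (- (r\<^sup>2 / 2)) * Z \<omega>"
        using sub[OF that] by (intro mult_left_mono) auto
      then have "1 \<le> exp (- (r\<^sup>2 / 2)) * Z \<omega>" by (simp add: exp_add[symmetric])
      then show ?thesis by (metis ennreal_1 ennreal_leI ennreal_mult' exp_ge_zero)
    qed
    \<comment> \<open>Markov's inequality for \<open>Z\<close> at level \<open>exp (r\<^sup>2 / 2)\<close>\<close>
    have "emeasure M {\<omega> \<in> space M. r \<le> W \<omega>} = (\<integral>\<^sup>+\<omega>. indicator {\<omega> \<in> space M. r \<le> W \<omega>} \<omega> \<partial>M)"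
      by simp
    also have "\<dots> \<le> (\<integral>\<^sup>+\<omega>. ennreal (exp (- (r\<^sup>2 / 2))) * ennreal (Z \<omega>) \<partial>M)"
      by (intro nn_integral_mono) (auto simp: indicator_def one)
    also have "\<dots> = ennreal (exp (- (r\<^sup>2 / 2))) * (\<integral>\<^sup>+\<omega>. ennreal (Z \<omega>) \<partial>M)"
      by (rule nn_integral_cmult) measurable
    also have "\<dots> \<le> ennreal (exp (- (r\<^sup>2 / 2))) * 1"
      by (intro mult_left_mono EZ) auto
    finally show ?thesis by simp
  qed
  have 1: "\<P>(\<omega> in M. x \<le> W \<omega>) \<le> exp (- (x\<^sup>2 / 2))"
    using tail[OF assms(6)] by (simp add: emeasure_eq_measure)

  \<comment> \<open>This scaling turns the Gaussian tail beyond \<open>sqrt 2\<close> into the unit exponential tail beyond 1.\<close>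
  define Q where "Q \<omega> = (W \<omega>)\<^sup>2 / 2" for \<omega>
  have [measurable]: "Q \<in> borel_measurable M" unfolding Q_def by measurable
  have tailQ: "emeasure M {\<omega> \<in> space M. u \<le> Q \<omega>} \<le> ennreal (exp (- u))" if u: "u \<ge> 1" for u
  proof -
    have "u \<le> Q \<omega> \<longleftrightarrow> sqrt (2 * u) \<le> W \<omega>" for \<omega>
      using u W0[of \<omega>] by (auto simp: Q_def intro: real_le_lsqrt dest: sqrt_le_D)
    then show ?thesis using tail[of "sqrt (2 * u)"] u by simp
  qed
  have WQ: "W \<omega> powr p = 2 powr (p / 2) * Q \<omega> powr (p / 2)" for \<omega>
  proof -
    have "W \<omega> powr p = (W \<omega> powr 2) powr (p / 2)" by (simp add: powr_powr)
    also have "W \<omega> powr 2 = 2 * Q \<omega>" using W0[of \<omega>] by (simp add: Q_def)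
    finally show ?thesis using W0[of \<omega>] by (simp add: powr_mult[symmetric] Q_def)
  qed
  have "(\<integral>\<^sup>+\<omega>. ennreal (W \<omega> powr p) \<partial>M)
      = ennreal (2 powr (p / 2)) * (\<integral>\<^sup>+\<omega>. ennreal (Q \<omega> powr (p / 2)) \<partial>M)"
    by (simp add: WQ ennreal_mult nn_integral_cmult)
  also have "\<dots> \<le> ennreal (2 powr (p / 2)) * ennreal (1 + p / 2 * Gamma (p / 2))"
    using p tailQ by (intro mult_left_mono nn_integral_powr_le_of_exp_tail prob_space_axioms) (auto simp: Q_def)
  also have "\<dots> = ennreal (2 powr (p / 2) * (1 + p / 2 * Gamma (p / 2)))"
    by (rule ennreal_mult'[symmetric]) simp
  also have "2 powr (p / 2) * (1 + p / 2 * Gamma (p / 2))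
      = 2 powr (p / 2) + 2 powr ((p - 2) / 2) * p * Gamma (p / 2)"
    by (simp add: diff_divide_distrib powr_diff algebra_simps)
  finally show ?thesis using 1 unfolding W_def by blast
qed

end
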